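(* Let $1\le m\le n$, let $A\in\mathbb{R}^{n\times n}$ be invertible, and let $W,V\in\mathbb{R}^{n\times m}$ be full-rank matrices with $\det(W^{T}AV)\neq 0$. Let $P_1=I-V\left(W^{T}AV\right)^{-1}W^{T}A$. Then: 1. $P_1$ is a projection operator, i.e. $P_1^2=P_1$. 2. $\mathrm{Range}(P_1)=\mathrm{Null}(W^{T}A)$. 3. The general form of a covariance matrix $\Sigma_0=VV^{T}+\Psi$, with $\Psi\in\mathbb{R}^{n\times n}$ symmetric positive semidefinite and $W^{T}A\Psi=0$, is $\Sigma_0=VV^{T}+P_1GP_1^{T}$ with $G\ge 0$; that is, $$\{VV^{T}+\Psi:\ \Psi\ge 0,\ W^{T}A\Psi=0\}=\{VV^{T}+P_1GP_1^{T}:\ G\in\mathbb{R}^{n\times n},\ G\ge 0\}.$$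
   Context: For a real square matrix $M$, $M\ge 0$ means that $M$ is symmetric positive semidefinite. *)

theory Defs
  imports "HOL-Analysis.Analysis"
begin

text \<open>Symmetry is part of the definition: over the reals it does not follow from
  nonnegativity of the quadratic form.\<close>

definition pos_semidef :: "real^'n^'n \<Rightarrow> bool" where
  "pos_semidef M \<longleftrightarrow> transpose M = M \<and> (\<forall>x. 0 \<le> x \<bullet> (M *v x))"

definition mat_range :: "real^'m^'n \<Rightarrow> (real^'n) set" where
  "mat_range M = range (\<lambda>x. M *v x)"

definition mat_null :: "real^'m^'n \<Rightarrow> (real^'m) set" where
  "mat_null M = {x. M *v x = 0}"

end

theory Submission
  imports Defs
begin

text \<open>Write \<open>B\<close> for \<open>transpose W ** A\<close> and \<open>K\<close> for
  \<open>V ** matrix_inv (B ** V)\<close>. The determinant hypothesis makes \<open>K\<close> a right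
  inverse of \<open>B\<close>, and \<open>P\<^sub>1\<close> is the identity minus
  \<open>K ** B\<close>. Two facts follow: \<open>B ** P\<^sub>1 = B - (B ** K) ** B = 0\<close>,
  and \<open>P\<^sub>1\<close> fixes whatever \<open>B\<close> annihilates. Together they say that
  \<open>P\<^sub>1\<close> projects onto the kernel of \<open>B\<close>. For the covariance form, a
  symmetric \<open>\<Psi>\<close> with \<open>B ** \<Psi> = 0\<close> is fixed by
  \<open>P\<^sub>1\<close> on the left and, after transposing, by \<open>transpose P\<^sub>1\<close>
  on the right, so \<open>G = \<Psi>\<close> represents it. Conversely, congruence by
  \<open>P\<^sub>1\<close> (\<open>pos_semidef_congruence\<close>) preserves semidefiniteness and
  gives a matrix killed by \<open>B\<close>.\<close>

lemma matrix_diff_ldistrib: "(A :: 'a::ring_1^'n^'m) ** (B - C) = A ** B - A ** C"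
  by (vector matrix_matrix_mult_def sum_subtractf right_diff_distrib)

lemma matrix_diff_rdistrib: "((A :: 'a::ring_1^'n^'m) - B) ** C = A ** C - B ** C"
  by (vector matrix_matrix_mult_def sum_subtractf left_diff_distrib)

lemma matrix_mult_zero_left [simp]: "(0 :: 'a::semiring_1^'n^'m) ** A = 0"
  by (vector matrix_matrix_mult_def)

lemma matrix_mult_zero_right [simp]: "(A :: 'a::semiring_1^'n^'m) ** 0 = 0"
  by (vector matrix_matrix_mult_def)

lemma matrix_inv_right:
  assumes "invertible A"
  shows "A ** matrix_inv A = mat 1"
  using assms unfolding invertible_def matrix_inv_def by (rule someI2_ex) (rule conjunct1)

text \<open>The quadratic form of the new matrix at \<open>x\<close> is that of \<open>M\<close> at
  \<open>transpose P *v x\<close>; symmetry survives because transposing reverses the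
  product.\<close>

lemma pos_semidef_congruence:
  fixes M P :: "real^'n^'n"
  assumes "pos_semidef M"
  shows "pos_semidef (P ** M ** transpose P)"
proof -
  have "x \<bullet> ((P ** M ** transpose P) *v x) = (transpose P *v x) \<bullet> (M *v (transpose P *v x))" for x
    by (simp add: dot_lmul_matrix[symmetric] matrix_vector_mul_assoc[symmetric])
  then show ?thesis
    using assms by (simp add: pos_semidef_def matrix_transpose_mul matrix_mul_assoc)
qed

theorem theorem4:
  fixes A :: "real^'n^'n" and W V :: "real^'m^'n" and P\<^sub>1 :: "real^'n^'n"
  assumes "CARD('m) \<le> CARD('n)"
    and "invertible A"
    and "rank W = CARD('m)" and "rank V = CARD('m)"
    and "det (transpose W ** A ** V) \<noteq> 0"
    and "P\<^sub>1 = mat 1 - V ** matrix_inv (transpose W ** A ** V) ** transpose W ** A"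
  shows "P\<^sub>1 ** P\<^sub>1 = P\<^sub>1
    \<and> mat_range P\<^sub>1 = mat_null (transpose W ** A)
    \<and> {V ** transpose V + \<Psi> | \<Psi> :: real^'n^'n. pos_semidef \<Psi> \<and> transpose W ** A ** \<Psi> = 0}
        = {V ** transpose V + P\<^sub>1 ** G ** transpose P\<^sub>1 | G :: real^'n^'n. pos_semidef G}"
proof -
  define B K where "B = transpose W ** A" and "K = V ** matrix_inv (B ** V)"
  have "invertible (B ** V)"
    using assms(5) by (simp add: B_def invertible_det_nz)
  then have BK: "B ** K = mat 1"
    unfolding K_def matrix_mul_assoc by (rule matrix_inv_right)
  have P: "P\<^sub>1 = mat 1 - K ** B"
    by (simp add: assms(6) B_def K_def matrix_mul_assoc)
  have BP: "B ** P\<^sub>1 = 0"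
    by (simp add: P matrix_diff_ldistrib matrix_mul_assoc BK)
  \<comment> \<open>The correction term \<open>K ** B ** M\<close> vanishes.\<close>
  have P_fix: "P\<^sub>1 ** M = M" if "B ** M = 0" for M :: "real^'n^'n"
    using that by (simp add: P matrix_diff_rdistrib matrix_mul_assoc[symmetric])
  have P_fixv: "P\<^sub>1 *v x = x" if "B *v x = 0" for x
    using that by (simp add: P matrix_vector_mult_diff_rdistrib matrix_vector_mul_assoc[symmetric])
  \<comment> \<open>The columns of \<open>P\<^sub>1\<close> lie in the kernel of \<open>B\<close>,
    so \<open>P\<^sub>1\<close> fixes itself.\<close>
  have idem: "P\<^sub>1 ** P\<^sub>1 = P\<^sub>1"
    by (rule P_fix[OF BP])
  have range: "mat_range P\<^sub>1 = mat_null B"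
  proof
    show "mat_range P\<^sub>1 \<subseteq> mat_null B"
      by (auto simp: mat_range_def mat_null_def matrix_vector_mul_assoc BP)
    \<comment> \<open>Each null vector of \<open>B\<close> is its own preimage under
      \<open>P\<^sub>1\<close>.\<close>
    show "mat_null B \<subseteq> mat_range P\<^sub>1"
      unfolding mat_range_def mat_null_def using P_fixv
      by (metis (mono_tags) mem_Collect_eq rangeI subsetI)
  qed
  \<comment> \<open>Symmetry of \<open>\<Psi>\<close> carries the left identity
    \<open>P\<^sub>1 ** \<Psi> = \<Psi>\<close> over to the right factor.\<close>
  have fwd: "P\<^sub>1 ** \<Psi> ** transpose P\<^sub>1 = \<Psi>" if "pos_semidef \<Psi>" "B ** \<Psi> = 0" for \<Psi> :: "real^'n^'n"
  proof -
    have "\<Psi> ** transpose P\<^sub>1 = transpose (P\<^sub>1 ** \<Psi>)"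
      using that(1) by (simp add: pos_semidef_def matrix_transpose_mul)
    then show ?thesis
      using P_fix[OF that(2)] that(1) by (simp add: pos_semidef_def)
  qed
  \<comment> \<open>The leftmost factor \<open>P\<^sub>1\<close> is already killed by
    \<open>B\<close>, whatever \<open>G\<close> is.\<close>
  have bwd: "pos_semidef (P\<^sub>1 ** G ** transpose P\<^sub>1) \<and> B ** (P\<^sub>1 ** G ** transpose P\<^sub>1) = 0"
    if "pos_semidef G" for G :: "real^'n^'n"
    using pos_semidef_congruence[OF that] by (simp add: matrix_mul_assoc BP)
  have "{V ** transpose V + \<Psi> | \<Psi> :: real^'n^'n. pos_semidef \<Psi> \<and> B ** \<Psi> = 0}
      = {V ** transpose V + P\<^sub>1 ** G ** transpose P\<^sub>1 | G :: real^'n^'n. pos_semidef G}" (is "?L = ?R")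
  proof (intro subset_antisym subsetI)
    fix \<Sigma> assume "\<Sigma> \<in> ?L"
    then obtain \<Psi> where \<Psi>: "\<Sigma> = V ** transpose V + \<Psi>" "pos_semidef \<Psi>" "B ** \<Psi> = 0"
      by auto
    \<comment> \<open>The witness for \<open>G\<close> is \<open>\<Psi>\<close> itself.\<close>
    have "\<Sigma> = V ** transpose V + P\<^sub>1 ** \<Psi> ** transpose P\<^sub>1"
      using \<Psi>(1) by (simp only: fwd[OF \<Psi>(2,3)])
    with \<Psi>(2) show "\<Sigma> \<in> ?R" by auto
  next
    fix \<Sigma> assume "\<Sigma> \<in> ?R"
    with bwd show "\<Sigma> \<in> ?L" by auto
  qed
  with idem range show ?thesis
    unfolding B_def by (intro conjI)
qed

end
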